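(* Let $n=2l$, $k=2t$ and $r$ be positive integers, where $l,t$ are positive integers, such that $tr\le l$. Then there is an absolutely flat idempotent with parameters $n,k,r$. In particular, whenever $n$ is an even positive integer and $k,r$ are positive integers for which there exist nonnegative integers $m,u$ with $n=rk+2m$ and $n-k=2u$, there is an absolutely flat idempotent with parameters $n,k,r$.
   Context: For positive integers $n,k,r$, an absolutely flat idempotent with parameters $n,k,r$ is a real $n\times n$ matrix $A$ with $A^2=A$, rank $r$, and every entry equal to $1/k$ or $-1/k$. *)

theory Defs
  imports Complex_Main "Jordan_Normal_Form.DL_Rank"
begin

text \<open>The parameters are required to be positive; in particular, the convention \<open>1 / 0 = 0\<close>
  plays no role.\<close>

definition absolutely_flat_idempotent :: "nat \<Rightarrow> nat \<Rightarrow> nat \<Rightarrow> real mat \<Rightarrow> bool" where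
  "absolutely_flat_idempotent n k r A \<longleftrightarrow>
     0 < n \<and> 0 < k \<and> 0 < r \<and>
     A \<in> carrier_mat n n \<and>
     A * A = A \<and>
     vec_space.rank n A = r \<and>
     (\<forall>i<n. \<forall>j<n. A $$ (i, j) = 1 / real k \<or> A $$ (i, j) = - (1 / real k))"

end

theory Submission
  imports Defs
begin

text \<open>
  Why the theorem holds. A matrix of rank \<open>r\<close> factors through dimension \<open>r\<close>, and here the core of
  the factorization is the \<open>r \<times> r\<close> sign matrix \<open>C\<close> with \<open>C a b = 1\<close> for \<open>a \<le> b\<close> and \<open>C a b = -1\<close>
  otherwise. Give it one more row, \<open>C r\<close>, which is constantly \<open>-1\<close>, that is, the negative of row \<open>0\<close>.
  Then \<open>C a - C (a + 1)\<close> is twice the \<open>a\<close>-th unit row vector for every \<open>a < r\<close>. So \<open>2 * t\<close> times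
  that unit vector is \<open>t * C a - t * C (a + 1)\<close>, a signed sum of \<open>2 * t\<close> rows, and the multiple
  \<open>2 * t\<close> of the inverse of \<open>C\<close> can be realised by counting signed indices, \<open>2 * t\<close> for each of
  the \<open>r\<close> classes. These are available because \<open>t * r \<le> l\<close>.

  Concretely, the index set \<open>{..<2 * l}\<close> is cut into consecutive blocks of length \<open>2 * t\<close>. Columns in
  block \<open>b < r\<close> of the \<open>\<plusminus>1\<close> matrix \<open>B\<close> are all equal; rows in block \<open>a < r\<close> alternate between
  row \<open>a\<close> and the negative of row \<open>a + 1\<close> of \<open>C\<close>. The sum of two neighbouring rows \<open>2 * q\<close>,
  \<open>2 * q + 1\<close> of \<open>B\<close> is therefore twice the indicator of one column class, or zero beyond the first
  \<open>r\<close> blocks (\<open>sum_neighbouring_rows\<close>). This single fact gives both the idempotency and the rank.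
  In \<open>B * B\<close> the neighbouring terms combine, as the left factor
  has equal neighbouring columns, and each column class collects the contributions of exactly \<open>t\<close>
  pairs, so \<open>B * B = 2 * t * B\<close> (\<open>staircase_square\<close>). And the functionals \<open>v \<mapsto> v (2 * q) +
  v (2 * q + 1)\<close> separate the \<open>r\<close> distinct columns, so these are linearly independent. The matrix
  sought is \<open>B / k\<close>.
\<close>

section \<open>A staircase of signs\<close>

text \<open>The last block is enlarged to contain all remaining indices, so that exactly the classes
  \<open>0, \<dots>, r - 1\<close> occur among the columns.\<close>

definition column_class :: "nat \<Rightarrow> nat \<Rightarrow> nat \<Rightarrow> nat" where
  "column_class t r j = min (j div (2 * t)) (r - 1)"

text \<open>Row \<open>i\<close> is, up to sign, row \<open>i div (2 * t) + i mod 2\<close> of the core matrix \<open>C\<close>. For rows beyond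
  the first \<open>r\<close> blocks this index is at least \<open>r\<close>, so such rows are constant and neighbouring ones
  cancel: the surplus indices contribute nothing to the square.\<close>

definition staircase :: "nat \<Rightarrow> nat \<Rightarrow> nat \<Rightarrow> nat \<Rightarrow> real" where
  "staircase t r i j = (- 1) ^ i * (if i div (2 * t) + i mod 2 \<le> column_class t r j then 1 else - 1)"

lemma staircase_cases: "staircase t r i j = 1 \<or> staircase t r i j = - 1"
  by (cases "even i") (auto simp: staircase_def)

lemma staircase_cong:
  "column_class t r j = column_class t r j' \<Longrightarrow> staircase t r i j = staircase t r i j'"
  by (simp add: staircase_def)

lemma div_double: "(2 * q) div (2 * t) = q div t" "Suc (2 * q) div (2 * t) = q div (t :: nat)"
  by (simp_all add: div_mult2_eq)

lemma column_class_Suc_double: "column_class t r (Suc (2 * q)) = column_class t r (2 * q)"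
  by (simp add: column_class_def div_double)

text \<open>In terms of \<open>C\<close>: the row vector \<open>C a - C (a + 1)\<close> is twice the \<open>a\<close>-th unit vector, as the
  inequalities \<open>a \<le> b\<close> and \<open>a + 1 \<le> b\<close> differ only at \<open>b = a\<close>.\<close>

lemma sum_neighbouring_rows:
  "staircase t r (2 * q) j + staircase t r (Suc (2 * q)) j =
    (if q div t = column_class t r j then 2 else 0)"
proof -
  have "Suc (2 * q) mod 2 = 1"
    by presburger
  then show ?thesis
    by (simp add: staircase_def div_double)
qed

lemma column_class_block_start:
  assumes "0 < t" "b < r"
  shows "column_class t r (2 * (b * t)) = b"
  using assms by (simp add: column_class_def div_double)

lemma sum_pairs:
  fixes f :: "nat \<Rightarrow> 'a :: comm_monoid_add"
  shows "(\<Sum>i<2 * l. f i) = (\<Sum>q<l. f (2 * q) + f (Suc (2 * q)))"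
  by (induction l) (simp_all add: ac_simps)

lemma quotient_fibre:
  assumes "0 < t" "b < r" "t * r \<le> l"
  shows "{q. q < l \<and> q div t = b} = {b * t..<b * t + (t :: nat)}"
proof -
  have "b * t + t \<le> r * t"
    using mult_le_mono1[of "Suc b" r t] \<open>b < r\<close> by simp
  also have "\<dots> \<le> l"
    using assms by (simp add: mult.commute)
  finally have "b * t + t \<le> l" .
  then show ?thesis
    using \<open>0 < t\<close> by (auto simp: div_nat_eqI mult.commute dividend_less_times_div)
      (metis div_mult_mod_eq mod_less_divisor nat_add_left_cancel_less mult.commute)
qed

text \<open>Summing over pairs of neighbours leaves only the pairs \<open>q\<close> whose block is the class of \<open>j\<close>.
  There are \<open>t\<close> of them, each with weight \<open>2\<close>, and for each the left factor is the entry at \<open>j\<close>,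
  since the column class of \<open>2 * q\<close> is that of \<open>j\<close>.\<close>

lemma staircase_square:
  assumes "0 < t" "0 < r" "t * r \<le> l"
  shows "(\<Sum>m<2 * l. staircase t r i m * staircase t r m j) = real (2 * t) * staircase t r i j"
proof -
  let ?b = "column_class t r j"
  have b: "?b < r"
    using \<open>0 < r\<close> by (simp add: column_class_def min_less_iff_disj)
  have pair: "staircase t r i (2 * q) * staircase t r (2 * q) j +
      staircase t r i (Suc (2 * q)) * staircase t r (Suc (2 * q)) j =
      (if q div t = ?b then 2 * staircase t r i j else 0)" for q
  proof -
    have "staircase t r i (Suc (2 * q)) = staircase t r i (2 * q)"
      by (rule staircase_cong) (rule column_class_Suc_double)
    then have "staircase t r i (2 * q) * staircase t r (2 * q) j +
        staircase t r i (Suc (2 * q)) * staircase t r (Suc (2 * q)) j =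
        staircase t r i (2 * q) * (if q div t = ?b then 2 else 0)"
      by (simp add: sum_neighbouring_rows flip: distrib_left)
    moreover have "staircase t r i (2 * q) = staircase t r i j" if "q div t = ?b"
      using that b by (intro staircase_cong) (simp add: column_class_def[of t r "2 * q"] div_double)
    ultimately show ?thesis
      by simp
  qed
  have "(\<Sum>m<2 * l. staircase t r i m * staircase t r m j) =
      (\<Sum>q<l. if q div t = ?b then 2 * staircase t r i j else 0)"
    by (simp add: sum_pairs pair)
  also have "\<dots> = (\<Sum>q | q < l \<and> q div t = ?b. 2 * staircase t r i j)"
    by (simp add: sum.If_cases Int_def)
  also have "\<dots> = real (2 * t) * staircase t r i j"
    by (simp add: quotient_fibre[OF \<open>0 < t\<close> b \<open>t * r \<le> l\<close>])
  finally show ?thesis .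
qed

section \<open>Linear independence and rank\<close>

text \<open>The functional \<open>v \<mapsto> v $ i + v $ j\<close> belonging to \<open>w\<close> reads off the coefficient of \<open>w\<close> in a linear
  combination of \<open>S\<close>, up to a nonzero factor.\<close>

lemma (in vec_space) lin_indpt_if_separated:
  assumes "finite S" and S: "S \<subseteq> carrier_vec n"
    and sep: "\<And>w. w \<in> S \<Longrightarrow>
      \<exists>i<n. \<exists>j<n. w $ i + w $ j \<noteq> 0 \<and> (\<forall>v\<in>S - {w}. v $ i + v $ j = 0)"
  shows "lin_indpt S"
proof (rule finite_lin_indpt2[OF \<open>finite S\<close>])
  show "S \<subseteq> carrier_vec n"
    by (rule S)
next
  fix a
  assume zero: "lincomb a S = 0\<^sub>v n"
  show "\<forall>w\<in>S. a w = 0"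
  proof
    fix w
    assume w: "w \<in> S"
    obtain i j where ij: "i < n" "j < n" "w $ i + w $ j \<noteq> 0"
      and others: "\<And>v. v \<in> S - {w} \<Longrightarrow> v $ i + v $ j = 0"
      using sep[OF w] by blast
    have "0 = lincomb a S $ i + lincomb a S $ j"
      using zero ij by simp
    also have "\<dots> = (\<Sum>v\<in>S. a v * (v $ i + v $ j))"
      using ij S by (simp add: lincomb_index sum.distrib distrib_left)
    also have "\<dots> = a w * (w $ i + w $ j)"
      using others \<open>finite S\<close> w by (subst sum.remove[of _ w]) simp_all
    finally show "a w = 0"
      using ij by simp
  qed
qed

lemma (in vec_space) rank_eq_card_cols:
  assumes "A \<in> carrier_mat n nc" "lin_indpt (set (cols A))"
  shows "rank A = card (set (cols A))"
  using assms by (intro rank_card_indpt) (auto simp: maximal_def)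

section \<open>The idempotent\<close>

lemma absolutely_flat_idempotent_exists:
  assumes t: "0 < t" and r: "0 < r" and trl: "t * r \<le> l"
  shows "\<exists>A. absolutely_flat_idempotent (2 * l) (2 * t) r A"
proof
  define n where "n = 2 * l"
  define A where "A = mat n n (\<lambda>(i, j). staircase t r i j / real (2 * t))"
  have A: "A \<in> carrier_mat n n"
    by (simp add: A_def)
  have "0 < t * r"
    using t r by simp
  with trl have n: "0 < n"
    unfolding n_def by linarith

  have idempotent: "A * A = A"
  proof (rule eq_matI)
    fix i j
    assume ij: "i < dim_row A" "j < dim_col A"
    then have "(A * A) $$ (i, j) = (\<Sum>m<n. staircase t r i m * staircase t r m j) / (real (2 * t))\<^sup>2"
      by (simp add: A_def scalar_prod_def power2_eq_square sum_divide_distrib atLeast0LessThan)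
    also have "\<dots> = A $$ (i, j)"
      using staircase_square[OF t r trl, of i j] ij t
      by (simp add: A_def n_def power2_eq_square)
    finally show "(A * A) $$ (i, j) = A $$ (i, j)" .
  qed (use A in auto)

  interpret vec_space "TYPE(real)" n .
  define c where "c b = col A (2 * (b * t))" for b
  have start: "Suc (2 * (b * t)) < n" if "b < r" for b
  proof -
    have "b * t < r * t"
      using that t by simp
    also have "\<dots> \<le> l"
      using trl by (simp add: mult.commute)
    finally show ?thesis
      by (simp add: n_def)
  qed
  have col_eq: "col A j = c (column_class t r j)" if "j < n" for j
  proof -
    have less: "column_class t r j < r"
      using r by (simp add: column_class_def min_less_iff_disj)
    show ?thesis
      unfolding c_def using that start[OF less] column_class_block_start[OF t less]
      by (intro eq_vecI) (auto simp: A_def intro: staircase_cong)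
  qed
  have cols: "set (cols A) = c ` {..<r}"
  proof (intro equalityI subsetI)
    fix v
    assume "v \<in> set (cols A)"
    then obtain j where "j < n" "v = col A j"
      using A by (auto simp: cols_def)
    then show "v \<in> c ` {..<r}"
      using col_eq r by (auto simp: column_class_def min_less_iff_disj)
  next
    fix v
    assume "v \<in> c ` {..<r}"
    then show "v \<in> set (cols A)"
      using A start[THEN Suc_lessD] by (auto simp: c_def cols_def)
  qed
  have functional: "c b $ (2 * (a * t)) + c b $ Suc (2 * (a * t)) = (if a = b then 1 / real t else 0)"
    if "a < r" "b < r" for a b
    using sum_neighbouring_rows[of t r "a * t" "2 * (b * t)"] start[OF that(1)] start[OF that(2)]
      column_class_block_start[OF t that(2)] t
    by (auto simp: c_def A_def simp flip: add_divide_distrib)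
  have inj: "inj_on c {..<r}"
  proof (rule inj_onI)
    fix a b
    assume "a \<in> {..<r}" "b \<in> {..<r}" "c a = c b"
    then show "a = b"
      using functional[of a b] functional[of a a] t by (auto split: if_splits)
  qed
  have "lin_indpt (set (cols A))"
  proof (rule lin_indpt_if_separated)
    show "set (cols A) \<subseteq> carrier_vec n"
      using A cols_dim by blast
  next
    fix w
    assume "w \<in> set (cols A)"
    then obtain a where a: "a < r" "w = c a"
      using cols by auto
    show "\<exists>i<n. \<exists>j<n. w $ i + w $ j \<noteq> 0 \<and> (\<forall>v\<in>set (cols A) - {w}. v $ i + v $ j = 0)"
    proof (intro exI conjI ballI)
      show "2 * (a * t) < n" "Suc (2 * (a * t)) < n"
        using start[OF a(1)] by simp_all
      show "w $ (2 * (a * t)) + w $ Suc (2 * (a * t)) \<noteq> 0"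
        using functional[OF a(1) a(1)] a t by simp
    next
      fix v
      assume "v \<in> set (cols A) - {w}"
      then obtain b where "b < r" "v = c b" "b \<noteq> a"
        using cols a by auto
      then show "v $ (2 * (a * t)) + v $ Suc (2 * (a * t)) = 0"
        using functional[OF a(1)] by simp
    qed
  qed simp
  then have "rank A = r"
    using A inj by (simp add: rank_eq_card_cols cols card_image)
  moreover have "A $$ (i, j) = 1 / real (2 * t) \<or> A $$ (i, j) = - (1 / real (2 * t))"
    if "i < n" "j < n" for i j
    using staircase_cases[of t r i j] that by (auto simp: A_def)
  ultimately show "absolutely_flat_idempotent (2 * l) (2 * t) r A"
    using A n t r idempotent unfolding absolutely_flat_idempotent_def n_def by simp
qed

text \<open>The second claim is a case of the first: \<open>n\<close> and \<open>n - k\<close> are even, hence so is \<open>k\<close>, and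
  \<open>n = r * k + 2 * m\<close> says that \<open>n div 2\<close> exceeds \<open>(k div 2) * r\<close> by \<open>m\<close>.\<close>

theorem theorem4p1:
  shows "(\<forall>n k r l t :: nat.
            0 < n \<and> 0 < k \<and> 0 < r \<and> 0 < l \<and> 0 < t \<and> n = 2 * l \<and> k = 2 * t \<and> t * r \<le> l \<longrightarrow>
            (\<exists>A. absolutely_flat_idempotent n k r A)) \<and>
         (\<forall>n k r :: nat.
            0 < n \<and> even n \<and> 0 < k \<and> 0 < r \<and>
            (\<exists>m u :: nat. n = r * k + 2 * m \<and> int n - int k = 2 * int u) \<longrightarrow>
            (\<exists>A. absolutely_flat_idempotent n k r A))"
proof (intro conjI allI impI; elim conjE exE)
  fix n k r l t :: nat
  assume "0 < r" "0 < t" "n = 2 * l" "k = 2 * t" "t * r \<le> l"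
  then show "\<exists>A. absolutely_flat_idempotent n k r A"
    using absolutely_flat_idempotent_exists by blast
next
  fix n k r m u :: nat
  assume pos: "0 < k" "0 < r" and "even n"
    and n: "n = r * k + 2 * m" and "int n - int k = 2 * int u"
  then have "even k"
    by presburger
  with \<open>even n\<close> obtain l t where lt: "n = 2 * l" "k = 2 * t"
    by (auto elim!: evenE)
  with n have "2 * l = 2 * (t * r + m)"
    by (simp add: algebra_simps)
  with pos lt have "0 < t" "t * r \<le> l"
    by auto
  with \<open>0 < r\<close> show "\<exists>A. absolutely_flat_idempotent n k r A"
    using absolutely_flat_idempotent_exists lt by blast
qed

end
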